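(* Let $\alpha,\beta\in\mathbb{Z}_{\geq0}^n$. If $\beta\preceq\alpha$, then $\beta$ is a vertex of $\mathsf{Newton}(\kappa_\alpha)\subseteq\mathbb{R}^n$.
   Context: For $f\in\mathbb{Z}[x_1,x_2,\ldots]$ let $\partial_i f=\frac{f-s_if}{x_i-x_{i+1}}$, where $s_i$ swaps $x_i$ and $x_{i+1}$, and let $\pi_i(f)=\partial_i(x_if)$. For a composition $\alpha=(\alpha_1,\alpha_2,\ldots)$ of nonnegative integers with finite sum, the key polynomial $\kappa_\alpha$ is $x^\alpha=x_1^{\alpha_1}x_2^{\alpha_2}\cdots$ if $\alpha$ is weakly decreasing, and otherwise $\kappa_\alpha=\pi_i(\kappa_{\widehat\alpha})$, where $i$ is such that $\alpha_{i+1}>\alpha_i$ and $\widehat\alpha$ is $\alpha$ with entries $i,i+1$ swapped (this is well defined). For $\gamma\in\mathbb{Z}^n_{\geq0}$, $\lambda(\gamma)$ is its decreasing rearrangement and $w(\gamma)\in S_n$ is the shortest-length permutation sending $\lambda(\gamma)$ to $\gamma$ by permuting coordinates. Write $\gamma\preceq\alpha$ if $\lambda(\gamma)=\lambda(\alpha)$ and $w(\gamma)\leq w(\alpha)$ in (strong) Bruhat order on $S_n$. $\mathsf{Newton}(f)$ is the convex hull of the exponent vectors of $f$. *)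

theory Defs
  imports "HOL-Analysis.Analysis" "HOL-Analysis.Finite_Function_Topology"
begin

(* Indices are 0-based: position/variable i below is the mathematical i + 1.  In particular S_n
   is the set of permutations of {..<n} and the adjacent transposition s_i swaps i and Suc i. *)

text \<open>
  Exponent vectors and compositions are finitely supported functions \<open>nat \<Rightarrow>\<^sub>0 nat\<close>;
  the polynomial ring in infinitely many variables is the monoid algebra over them, with
  the convolution product of \<^theory>\<open>HOL-Library.Poly_Mapping\<close>.
\<close>

type_synonym composition = "nat \<Rightarrow>\<^sub>0 nat"
type_synonym polynomial = "(nat \<Rightarrow>\<^sub>0 nat) \<Rightarrow>\<^sub>0 int"

definition xmonom :: "composition \<Rightarrow> polynomial" where
  "xmonom a = Poly_Mapping.single a 1"

definition xvar :: "nat \<Rightarrow> polynomial" where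
  "xvar i = xmonom (Poly_Mapping.single i 1)"

definition swap_entries :: "nat \<Rightarrow> composition \<Rightarrow> composition" where
  "swap_entries i a = Poly_Mapping.map_key (Transposition.transpose i (Suc i)) a"

(* map_key precomposes the coefficient function with its argument; as swap_entries i is an
   involution, this sends the monomial with exponent e to the one with exponent swap_entries i e. *)
definition swap_vars :: "nat \<Rightarrow> polynomial \<Rightarrow> polynomial" where
  "swap_vars i f = Poly_Mapping.map_key (swap_entries i) f"

(* The quotient exists for every f, and is unique because the polynomial ring is a domain. *)
definition divdiff :: "nat \<Rightarrow> polynomial \<Rightarrow> polynomial" where
  "divdiff i f = (THE g. (xvar i - xvar (Suc i)) * g = f - swap_vars i f)"

definition demazure :: "nat \<Rightarrow> polynomial \<Rightarrow> polynomial" where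
  "demazure i f = divdiff i (xvar i * f)"

lemma lookup_swap_entries:
  "Poly_Mapping.lookup (swap_entries i a) j =
     Poly_Mapping.lookup a (Transposition.transpose i (Suc i) j)"
  by (simp add: swap_entries_def Poly_Mapping.map_key.rep_eq)

lemma inj_swap_entries: "inj (swap_entries i)"
  by (rule inj_on_inverseI[where g = "swap_entries i"])
     (simp add: poly_mapping_eq_iff fun_eq_iff lookup_swap_entries)

lemma lookup_swap_vars:
  "Poly_Mapping.lookup (swap_vars i f) e = Poly_Mapping.lookup f (swap_entries i e)"
  by (simp add: swap_vars_def Poly_Mapping.map_key.rep_eq inj_swap_entries)

definition weight :: "composition \<Rightarrow> nat" where
  "weight a = (\<Sum>k\<in>Poly_Mapping.keys a. k * Poly_Mapping.lookup a k)"

lemma weight_eq: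
  assumes "finite S" "Poly_Mapping.keys a \<subseteq> S"
  shows "weight a = (\<Sum>k\<in>S. k * Poly_Mapping.lookup a k)"
  unfolding weight_def using assms
  by (intro sum.mono_neutral_left) (auto simp: in_keys_iff)

lemma weight_swap_entries:
  assumes "Poly_Mapping.lookup a i < Poly_Mapping.lookup a (Suc i)"
  shows "weight (swap_entries i a) < weight a"
proof -
  let ?t = "Transposition.transpose i (Suc i)"
  let ?L = "Poly_Mapping.lookup a"
  define S where "S = Poly_Mapping.keys a - {i, Suc i}"
  have fin: "finite S" by (simp add: S_def)
  have sub: "Poly_Mapping.keys a \<subseteq> insert i (insert (Suc i) S)"
    by (auto simp: S_def)
  have sub': "Poly_Mapping.keys (swap_entries i a) \<subseteq> insert i (insert (Suc i) S)"
    by (auto simp: S_def in_keys_iff lookup_swap_entries Transposition.transpose_def split: if_splits)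
  have rest: "(\<Sum>k\<in>S. k * ?L (?t k)) = (\<Sum>k\<in>S. k * ?L k)"
    by (intro sum.cong) (auto simp: S_def Transposition.transpose_def)
  have nin: "i \<notin> S" "Suc i \<notin> S" by (auto simp: S_def)
  have "weight a = i * ?L i + (Suc i * ?L (Suc i) + (\<Sum>k\<in>S. k * ?L k))"
    using fin nin by (subst weight_eq[OF _ sub]) auto
  moreover have "weight (swap_entries i a) =
      i * ?L (Suc i) + (Suc i * ?L i + (\<Sum>k\<in>S. k * ?L k))"
    using fin nin rest by (subst weight_eq[OF _ sub']) (auto simp: lookup_swap_entries)
  ultimately show ?thesis using assms by simp
qed

(* The result does not depend on which ascent i is used; the definition picks an arbitrary one. *)
function key_poly :: "composition \<Rightarrow> polynomial" where
  "key_poly a =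
     (if antimono (Poly_Mapping.lookup a) then xmonom a
      else let i = (SOME i. Poly_Mapping.lookup a i < Poly_Mapping.lookup a (Suc i))
           in demazure i (key_poly (swap_entries i a)))"
  by pat_completeness auto
termination
proof (relation "Wellfounded.measure weight")
  fix a :: composition and i
  assume na: "\<not> antimono (Poly_Mapping.lookup a)"
    and i: "i = (SOME i. Poly_Mapping.lookup a i < Poly_Mapping.lookup a (Suc i))"
  from na have "\<exists>i. Poly_Mapping.lookup a i < Poly_Mapping.lookup a (Suc i)"
    unfolding antimono_iff_le_Suc by (auto simp: not_le)
  then have "Poly_Mapping.lookup a i < Poly_Mapping.lookup a (Suc i)"
    unfolding i by (rule someI_ex)
  then show "(swap_entries i a, a) \<in> Wellfounded.measure weight"
    by (simp add: weight_swap_entries)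
qed simp

declare key_poly.simps [simp del]

text \<open>
  The ambient space is the real vector space \<open>nat \<Rightarrow>\<^sub>0 real\<close>, which contains every
  \<open>\<real>\<^sup>n\<close> as the subspace of vectors supported on the first \<open>n\<close> coordinates.
\<close>

definition real_vec :: "composition \<Rightarrow> (nat \<Rightarrow>\<^sub>0 real)" where
  "real_vec a = Poly_Mapping.map real a"

definition euclid :: "nat \<Rightarrow> (nat \<Rightarrow>\<^sub>0 real) set" where
  "euclid n = {v. Poly_Mapping.keys v \<subseteq> {..<n}}"

definition Newton :: "polynomial \<Rightarrow> (nat \<Rightarrow>\<^sub>0 real) set" where
  "Newton f = convex hull (real_vec ` Poly_Mapping.keys f)"

definition inversions :: "nat \<Rightarrow> (nat \<Rightarrow> nat) \<Rightarrow> (nat \<times> nat) set" where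
  "inversions n w = {(i, j). i < j \<and> j < n \<and> w j < w i}"

definition perm_length :: "nat \<Rightarrow> (nat \<Rightarrow> nat) \<Rightarrow> nat" where
  "perm_length n w = card (inversions n w)"

definition bruhat_step :: "nat \<Rightarrow> (nat \<Rightarrow> nat) \<Rightarrow> (nat \<Rightarrow> nat) \<Rightarrow> bool" where
  "bruhat_step n u v \<longleftrightarrow>
     (\<exists>i j. i < j \<and> j < n \<and> v = u \<circ> Transposition.transpose i j \<and>
            perm_length n u < perm_length n v)"

definition bruhat_le :: "nat \<Rightarrow> (nat \<Rightarrow> nat) \<Rightarrow> (nat \<Rightarrow> nat) \<Rightarrow> bool" where
  "bruhat_le n u v \<longleftrightarrow>
     u permutes {..<n} \<and> v permutes {..<n} \<and> (bruhat_step n)\<^sup>*\<^sup>* u v"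

(* Elements of Z_{>=0}^n are lists of length n. *)

definition dec_rearr :: "nat list \<Rightarrow> nat list" where
  "dec_rearr g = rev (sort g)"

(* S_n acts by (w . v)_{w(i)} = v_i. *)
definition sends :: "(nat \<Rightarrow> nat) \<Rightarrow> nat list \<Rightarrow> nat list \<Rightarrow> bool" where
  "sends w v g \<longleftrightarrow>
     length v = length g \<and> w permutes {..<length g} \<and> (\<forall>i<length g. g ! w i = v ! i)"

definition min_perm :: "nat list \<Rightarrow> (nat \<Rightarrow> nat)" where
  "min_perm g = (ARG_MIN (perm_length (length g)) w. sends w (dec_rearr g) g)"

definition comp_le :: "nat list \<Rightarrow> nat list \<Rightarrow> bool" (infix \<open>\<preceq>\<close> 50) where
  "b \<preceq> a \<longleftrightarrow>
     dec_rearr b = dec_rearr a \<and> bruhat_le (length a) (min_perm b) (min_perm a)"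

(* Poly_Mapping.nth extends a list by zeros. *)
abbreviation pad :: "nat list \<Rightarrow> composition" where
  "pad a \<equiv> Poly_Mapping.nth a"

end

theory Submission
  imports Defs
begin

text \<open>
  The isobaric divided difference \<open>\<pi>\<^sub>i\<close> never increases the Euclidean norm of
  an exponent vector, and it acts on the coefficients at exponents of maximal norm by
  a mere relabelling: the coefficient at \<open>e\<close> is the old one at whichever of \<open>e\<close>,
  \<open>s\<^sub>i e\<close> is weakly decreasing in positions \<open>i, i + 1\<close>.  Hence every exponent of the
  key polynomial of \<open>\<alpha>\<close> has norm at most that of \<open>\<alpha>\<close>, and, by the lifting property of
  Bruhat order, each rearrangement \<open>\<beta> \<preceq> \<alpha>\<close> has coefficient 1.  Strict convexity of
  the norm then makes such \<open>\<beta>\<close> extreme.  Bruhat order enters only through the tableau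
  criterion: every prefix of \<open>\<beta>\<close> contains at least as many entries above any threshold as
  the same prefix of \<open>\<alpha>\<close>.
\<close>

section \<open>Isobaric divided differences\<close>

text \<open>Divided differences alter only the exponents at \<open>i\<close> and
  \<open>Suc i\<close>, so every exponent arising from \<open>e\<close> is \<open>e\<close> with
  these two entries overwritten.\<close>

definition set_pair :: "nat \<Rightarrow> composition \<Rightarrow> nat \<Rightarrow> nat \<Rightarrow> composition" where
  "set_pair i e p q = Poly_Mapping.update i p (Poly_Mapping.update (Suc i) q e)"

lemma lookup_set_pair:
  "Poly_Mapping.lookup (set_pair i e p q) j =
     (if j = i then p else if j = Suc i then q else Poly_Mapping.lookup e j)"
  by (auto simp: set_pair_def lookup_update)

lemma set_pair_eq_iff:
  "e' = set_pair i e p q \<longleftrightarrow>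
     Poly_Mapping.lookup e' i = p \<and> Poly_Mapping.lookup e' (Suc i) = q \<and>
     (\<forall>j. j \<noteq> i \<longrightarrow> j \<noteq> Suc i \<longrightarrow> Poly_Mapping.lookup e' j = Poly_Mapping.lookup e j)"
  (is "?L \<longleftrightarrow> ?R")
proof
  show "?L \<Longrightarrow> ?R" by (simp add: lookup_set_pair)
  show "?L" if "?R" by (rule poly_mapping_eqI) (simp add: lookup_set_pair that)
qed

lemma set_pair_inject [simp]:
  "set_pair i e p q = set_pair i e p' q' \<longleftrightarrow> p = p' \<and> q = q'"
  by (auto simp: set_pair_eq_iff lookup_set_pair)

lemma set_pair_self [simp]:
  "set_pair i e (Poly_Mapping.lookup e i) (Poly_Mapping.lookup e (Suc i)) = e"
  by (rule poly_mapping_eqI) (auto simp: lookup_set_pair)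

lemma swap_entries_eq_set_pair:
  "swap_entries i e = set_pair i e (Poly_Mapping.lookup e (Suc i)) (Poly_Mapping.lookup e i)"
  by (rule poly_mapping_eqI)
     (auto simp: lookup_set_pair lookup_swap_entries Transposition.transpose_def)

lemma swap_entries_involutive [simp]: "swap_entries i (swap_entries i e) = e"
  by (rule poly_mapping_eqI) (simp add: lookup_swap_entries)

lemma swap_entries_set_pair [simp]: "swap_entries i (set_pair i e p q) = set_pair i e q p"
  by (rule poly_mapping_eqI)
     (auto simp: lookup_set_pair lookup_swap_entries Transposition.transpose_def)

lemma lookup_swap_entries_here [simp]:
  "Poly_Mapping.lookup (swap_entries i e) i = Poly_Mapping.lookup e (Suc i)"
  "Poly_Mapping.lookup (swap_entries i e) (Suc i) = Poly_Mapping.lookup e i"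
  by (simp_all add: lookup_swap_entries)

lemma lookup_swap_entries_other [simp]:
  "j \<noteq> i \<Longrightarrow> j \<noteq> Suc i \<Longrightarrow> Poly_Mapping.lookup (swap_entries i e) j = Poly_Mapping.lookup e j"
  by (simp add: lookup_swap_entries Transposition.transpose_def)

lemma xvar_mult_set_pair:
  "xvar i * Poly_Mapping.single (set_pair i e p q) c = Poly_Mapping.single (set_pair i e (Suc p) q) c"
  "xvar (Suc i) * Poly_Mapping.single (set_pair i e p q) c = Poly_Mapping.single (set_pair i e p (Suc q)) c"
proof -
  have "Poly_Mapping.single i 1 + set_pair i e p q = set_pair i e (Suc p) q"
    "Poly_Mapping.single (Suc i) 1 + set_pair i e p q = set_pair i e p (Suc q)"
    by (rule poly_mapping_eqI; simp add: lookup_add lookup_single lookup_set_pair when_def)+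
  then show
    "xvar i * Poly_Mapping.single (set_pair i e p q) c = Poly_Mapping.single (set_pair i e (Suc p) q) c"
    "xvar (Suc i) * Poly_Mapping.single (set_pair i e p q) c = Poly_Mapping.single (set_pair i e p (Suc q)) c"
    by (simp_all add: xvar_def xmonom_def mult_single)
qed

text \<open>With x, y the variables \<open>i\<close>, \<open>Suc i\<close>, this is (x^(b+m) y^b -
  x^b y^(b+m)) / (x - y), times \<open>c\<close> and the other variables of
  \<open>e\<close>.\<close>

definition geom_strip :: "nat \<Rightarrow> composition \<Rightarrow> int \<Rightarrow> nat \<Rightarrow> nat \<Rightarrow> polynomial" where
  "geom_strip i e c b m = (\<Sum>k<m. Poly_Mapping.single (set_pair i e (b + k) (b + m - Suc k)) c)"

text \<open>The bases \<open>b\<close> and \<open>d\<close> are kept apart for the induction: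
  removing the last summand leaves a sum of the same shape with \<open>Suc d\<close> for
  \<open>d\<close> and \<open>b\<close> unchanged.\<close>

lemma set_pair_sum_telescope:
  "(xvar i - xvar (Suc i)) *
     (\<Sum>k<m. Poly_Mapping.single (set_pair i e (b + k) (d + m - Suc k)) c) =
   Poly_Mapping.single (set_pair i e (b + m) d) c - Poly_Mapping.single (set_pair i e b (d + m)) c"
proof (induction m arbitrary: d)
  case (Suc m)
  show ?case
    using Suc.IH[of "Suc d"]
    by (simp add: distrib_left left_diff_distrib xvar_mult_set_pair)
qed simp

lemma geom_strip_mult:
  "(xvar i - xvar (Suc i)) * geom_strip i e c b m =
   Poly_Mapping.single (set_pair i e (b + m) b) c - Poly_Mapping.single (set_pair i e b (b + m)) c"
  unfolding geom_strip_def by (rule set_pair_sum_telescope)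

lemma lookup_geom_strip:
  "Poly_Mapping.lookup (geom_strip i e c b m) e' =
     (if \<exists>k<m. e' = set_pair i e (b + k) (b + m - Suc k) then c else 0)"
proof (cases "\<exists>k<m. e' = set_pair i e (b + k) (b + m - Suc k)")
  case True
  then obtain l where l: "l < m" "e' = set_pair i e (b + l) (b + m - Suc l)" by blast
  have "(\<Sum>k<m. Poly_Mapping.lookup (Poly_Mapping.single (set_pair i e (b + k) (b + m - Suc k)) c) e')
      = (\<Sum>k<m. if k = l then c else 0)"
    by (rule sum.cong) (auto simp: lookup_single l when_def)
  then show ?thesis using True l by (simp add: geom_strip_def lookup_sum)
next
  case False
  then show ?thesis by (auto simp: geom_strip_def lookup_sum lookup_single when_def intro!: sum.neutral)
qed

lemma swap_vars_add: "swap_vars i (f + g) = swap_vars i f + swap_vars i g"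
  by (rule poly_mapping_eqI) (simp add: lookup_swap_vars lookup_add)

lemma swap_vars_zero: "swap_vars i 0 = 0"
  by (rule poly_mapping_eqI) (simp add: lookup_swap_vars)

lemma swap_vars_sum: "swap_vars i (\<Sum>e\<in>S. f e) = (\<Sum>e\<in>S. swap_vars i (f e))"
  by (induction S rule: infinite_finite_induct) (simp_all add: swap_vars_zero swap_vars_add)

lemma swap_vars_single:
  "swap_vars i (Poly_Mapping.single e c) = Poly_Mapping.single (swap_entries i e) c"
proof -
  have "e = swap_entries i e' \<longleftrightarrow> swap_entries i e = e'" for e'
    by auto
  then show ?thesis
    by (intro poly_mapping_eqI) (simp add: lookup_swap_vars lookup_single)
qed

text \<open>After multiplication by \<open>xvar i\<close> the two exponents are \<open>Suc a\<close>
  and \<open>b\<close>; the smaller is the base of the strip, and the sign records which one it is.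
  For \<open>b = Suc a\<close> the strip is empty.\<close>

definition demazure_single :: "nat \<Rightarrow> composition \<Rightarrow> int \<Rightarrow> polynomial" where
  "demazure_single i e c =
     (let a = Poly_Mapping.lookup e i; b = Poly_Mapping.lookup e (Suc i) in
      if b \<le> a then geom_strip i e c b (Suc a - b) else - geom_strip i e c (Suc a) (b - Suc a))"

lemma demazure_single_mult:
  "(xvar i - xvar (Suc i)) * demazure_single i e c =
     xvar i * Poly_Mapping.single e c - swap_vars i (xvar i * Poly_Mapping.single e c)"
proof -
  let ?a = "Poly_Mapping.lookup e i" and ?b = "Poly_Mapping.lookup e (Suc i)"
  have "xvar i * Poly_Mapping.single e c = Poly_Mapping.single (set_pair i e (Suc ?a) ?b) c"
    using xvar_mult_set_pair(1)[of i e ?a ?b c] by simp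
  then show ?thesis
    by (simp add: demazure_single_def Let_def geom_strip_mult swap_vars_single)
qed

lemma xvar_diff_nonzero: "xvar i - xvar (Suc i) \<noteq> 0"
proof
  assume "xvar i - xvar (Suc i) = 0"
  then have "Poly_Mapping.lookup (xvar i) (Poly_Mapping.single i 1) =
      Poly_Mapping.lookup (xvar (Suc i)) (Poly_Mapping.single i 1)"
    by simp
  moreover have "Poly_Mapping.single (Suc i) (1::nat) \<noteq> Poly_Mapping.single i 1"
    by (metis lookup_single_eq lookup_single_not_eq n_not_Suc_n zero_neq_one)
  ultimately show False by (simp add: xvar_def xmonom_def lookup_single when_def)
qed

lemma divdiff_eqI:
  assumes "(xvar i - xvar (Suc i)) * g = f - swap_vars i f"
  shows "divdiff i f = g"
  unfolding divdiff_def
proof (rule the_equality)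
  fix h assume "(xvar i - xvar (Suc i)) * h = f - swap_vars i f"
  with assms have "(xvar i - xvar (Suc i)) * h = (xvar i - xvar (Suc i)) * g" by simp
  then show "h = g" using xvar_diff_nonzero by simp
qed (rule assms)

lemma sum_single_keys:
  "(\<Sum>e\<in>Poly_Mapping.keys f. Poly_Mapping.single e (Poly_Mapping.lookup f e)) = f"
  by (rule poly_mapping_eqI)
     (auto simp: lookup_sum lookup_single when_def sum.delta in_keys_iff)

text \<open>Linearity is not visible in the definite description behind \<open>divdiff\<close>. The
  sum of the quotients of the single terms satisfies the defining equation, and cancellation makes
  that solution unique.\<close>

lemma demazure_eq_sum:
  "demazure i f = (\<Sum>e\<in>Poly_Mapping.keys f. demazure_single i e (Poly_Mapping.lookup f e))"
  (is "_ = ?g")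
  unfolding demazure_def
proof (rule divdiff_eqI)
  let ?s = "\<lambda>e. Poly_Mapping.single e (Poly_Mapping.lookup f e)"
  have xf: "xvar i * f = (\<Sum>e\<in>Poly_Mapping.keys f. xvar i * ?s e)"
    by (subst (1) sum_single_keys[of f, symmetric]) (rule sum_distrib_left)
  show "(xvar i - xvar (Suc i)) * ?g = xvar i * f - swap_vars i (xvar i * f)"
    unfolding xf
    by (simp add: sum_distrib_left demazure_single_mult swap_vars_sum sum_subtractf)
qed

section \<open>Exponents of maximal norm\<close>

definition sq_norm :: "nat \<Rightarrow> composition \<Rightarrow> nat" where
  "sq_norm n e = (\<Sum>j<n. (Poly_Mapping.lookup e j)\<^sup>2)"

lemma sq_norm_split:
  assumes "Suc i < n"
  shows "sq_norm n e = (Poly_Mapping.lookup e i)\<^sup>2 + (Poly_Mapping.lookup e (Suc i))\<^sup>2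
           + (\<Sum>j\<in>{..<n} - {i, Suc i}. (Poly_Mapping.lookup e j)\<^sup>2)"
proof -
  have "{..<n} = insert i (insert (Suc i) ({..<n} - {i, Suc i}))" using assms by auto
  then have "sq_norm n e = (\<Sum>j\<in>insert i (insert (Suc i) ({..<n} - {i, Suc i})). (Poly_Mapping.lookup e j)\<^sup>2)"
    by (simp only: sq_norm_def)
  then show ?thesis by simp
qed

lemma sq_norm_set_pair:
  assumes "Suc i < n"
  shows "sq_norm n (set_pair i e p q) + (Poly_Mapping.lookup e i)\<^sup>2 + (Poly_Mapping.lookup e (Suc i))\<^sup>2
    = sq_norm n e + p\<^sup>2 + q\<^sup>2"
proof -
  have "(\<Sum>j\<in>{..<n} - {i, Suc i}. (Poly_Mapping.lookup (set_pair i e p q) j)\<^sup>2) =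
        (\<Sum>j\<in>{..<n} - {i, Suc i}. (Poly_Mapping.lookup e j)\<^sup>2)"
    by (rule sum.cong) (auto simp: lookup_set_pair)
  then show ?thesis
    using assms by (simp add: sq_norm_split lookup_set_pair)
qed

lemma sq_norm_swap_entries:
  assumes "Suc i < n" shows "sq_norm n (swap_entries i e) = sq_norm n e"
  using sq_norm_set_pair[OF assms, of e "Poly_Mapping.lookup e (Suc i)" "Poly_Mapping.lookup e i"]
  by (simp add: swap_entries_eq_set_pair)

lemma keys_set_pair_subset:
  assumes "Poly_Mapping.keys e \<subseteq> {..<n}" "Suc i < n"
  shows "Poly_Mapping.keys (set_pair i e p q) \<subseteq> {..<n}"
  using assms by (auto simp: in_keys_iff lookup_set_pair subset_iff split: if_splits)

lemma keys_swap_entries_subset: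
  assumes "Poly_Mapping.keys e \<subseteq> {..<n}" "Suc i < n"
  shows "Poly_Mapping.keys (swap_entries i e) \<subseteq> {..<n}"
  unfolding swap_entries_eq_set_pair using assms by (rule keys_set_pair_subset)

definition sort_pair :: "nat \<Rightarrow> composition \<Rightarrow> composition" where
  "sort_pair i e =
     (if Poly_Mapping.lookup e (Suc i) \<le> Poly_Mapping.lookup e i then e else swap_entries i e)"

text \<open>The two entries have constant sum along a strip; \<open>2 * k * (m - Suc k)\<close> is
  the exact loss in squared norm and vanishes only at the two ends.\<close>

lemma sum_squares_shift:
  fixes b m k :: nat
  assumes "k < m"
  shows "(b + k)\<^sup>2 + (b + m - Suc k)\<^sup>2 + 2 * k * (m - Suc k) = b\<^sup>2 + (b + (m - 1))\<^sup>2"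
proof -
  obtain r where "m = Suc (k + r)" using assms less_imp_Suc_add by blast
  then show ?thesis by (simp add: power2_eq_square algebra_simps)
qed

text \<open>If \<open>e\<close> is weakly decreasing at \<open>i\<close>, the strip runs from
  \<open>swap_entries i e\<close> to \<open>e\<close>, and the norm is attained only at these ends.
  Otherwise the strip lies strictly between \<open>e\<close> and its swap, where the norm is
  smaller.\<close>

lemma demazure_single_exponent:
  assumes "Poly_Mapping.lookup (demazure_single i e c) e' \<noteq> 0" and "Suc i < n"
  obtains p q where "e' = set_pair i e p q" "sq_norm n e' \<le> sq_norm n e"
    "sq_norm n e' = sq_norm n e \<Longrightarrow> sort_pair i e' = e"
    "Poly_Mapping.lookup e i < Poly_Mapping.lookup e (Suc i) \<Longrightarrow> sq_norm n e' < sq_norm n e"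
proof -
  define a b where "a = Poly_Mapping.lookup e i" and "b = Poly_Mapping.lookup e (Suc i)"
  show ?thesis
  proof (cases "b \<le> a")
    case True
    then obtain k where k: "k < Suc a - b" and e': "e' = set_pair i e (b + k) (b + (Suc a - b) - Suc k)"
      using assms(1)
      by (auto simp: demazure_single_def Let_def a_def[symmetric] b_def[symmetric] lookup_geom_strip
          split: if_splits)
    have sq: "sq_norm n e' + 2 * k * (Suc a - b - Suc k) = sq_norm n e"
      using sq_norm_set_pair[OF assms(2), of e "b + k" "b + (Suc a - b) - Suc k"]
        sum_squares_shift[OF k, of b] True e' by (simp add: a_def[symmetric] b_def[symmetric])
    have ends: "sort_pair i e' = e" if "sq_norm n e' = sq_norm n e"
    proof -
      have "k = 0 \<or> k = a - b" using sq that k by auto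
      then have "e' = swap_entries i e \<or> e' = e"
      proof
        assume "k = 0"
        then have "e' = set_pair i e b a" using True e' by simp
        then show ?thesis by (simp add: swap_entries_eq_set_pair a_def b_def)
      next
        assume "k = a - b"
        then have "e' = set_pair i e a b" using True e' by simp
        then show ?thesis by (simp add: a_def b_def)
      qed
      then show ?thesis
      proof
        assume "e' = swap_entries i e"
        \<comment> \<open>For \<open>a = b\<close>, \<open>sort_pair\<close> leaves the swapped
          vector alone, so that vector has to be \<open>e\<close> already.\<close>
        moreover have "swap_entries i e = e" if "a = b"
          using that by (simp add: swap_entries_eq_set_pair a_def b_def)
            (metis set_pair_self)
        ultimately show ?thesis using True
          by (auto simp: sort_pair_def a_def b_def)
      next
        assume "e' = e" then show ?thesis using True by (simp add: sort_pair_def a_def b_def)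
      qed
    qed
    show ?thesis
      by (rule that[OF e']) (use sq True ends in \<open>auto simp: a_def b_def\<close>)
  next
    case False
    then obtain k where k: "k < b - Suc a" and e': "e' = set_pair i e (Suc a + k) (Suc a + (b - Suc a) - Suc k)"
      using assms(1)
      by (auto simp: demazure_single_def Let_def a_def[symmetric] b_def[symmetric] lookup_geom_strip
          split: if_splits)
    \<comment> \<open>The new entries become a+1+k and a+1+r, free of truncated subtraction; the
      squared norm drops by 2(k+1)(r+1).\<close>
    define r where "r = b - Suc a - Suc k"
    have b: "b = Suc (Suc (a + k + r))" using k by (simp add: r_def)
    have "(Suc a + k)\<^sup>2 + (Suc a + (b - Suc a) - Suc k)\<^sup>2 < a\<^sup>2 + b\<^sup>2"
      unfolding b by (simp add: power2_eq_square algebra_simps)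
    then have "sq_norm n e' < sq_norm n e"
      using sq_norm_set_pair[OF assms(2), of e "Suc a + k" "Suc a + (b - Suc a) - Suc k"] e'
      by (simp add: a_def[symmetric] b_def[symmetric])
    then show ?thesis by (intro that[OF e']) auto
  qed
qed

text \<open>If \<open>e\<close> is the sorted form of \<open>e'\<close>, then \<open>e'\<close> is
  an end of the strip of \<open>e\<close>. Conversely, occurrence of \<open>e'\<close> forces equal
  norms, hence \<open>sort_pair i e' = e\<close>.\<close>

lemma lookup_demazure_single_top:
  assumes "sq_norm n e \<le> sq_norm n e'" and "Suc i < n"
  shows "Poly_Mapping.lookup (demazure_single i e c) e' = (if e = sort_pair i e' then c else 0)"
proof (cases "e = sort_pair i e'")
  case True
  define a b where "a = Poly_Mapping.lookup e i" and "b = Poly_Mapping.lookup e (Suc i)"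
  have ba: "b \<le> a" using True by (auto simp: a_def b_def sort_pair_def)
  have "e' = e \<or> e' = swap_entries i e"
    using True by (auto simp: sort_pair_def split: if_splits)
  \<comment> \<open>The two ends of the strip: \<open>k = a - b\<close> gives \<open>e\<close> and
    \<open>k = 0\<close> gives its swap.\<close>
  then have "e' = set_pair i e (b + (a - b)) (b + (Suc a - b) - Suc (a - b)) \<or>
      e' = set_pair i e (b + 0) (b + (Suc a - b) - Suc 0)"
    using ba by (auto simp: swap_entries_eq_set_pair a_def b_def)
  moreover have "a - b < Suc a - b" "0 < Suc a - b" using ba by auto
  ultimately have "\<exists>k<Suc a - b. e' = set_pair i e (b + k) (b + (Suc a - b) - Suc k)" by blast
  moreover have "demazure_single i e c = geom_strip i e c b (Suc a - b)"
    using ba by (simp add: demazure_single_def Let_def a_def b_def)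
  ultimately have "Poly_Mapping.lookup (demazure_single i e c) e' = c"
    by (simp only: lookup_geom_strip if_True)
  then show ?thesis using True by simp
next
  case False
  then show ?thesis
    using demazure_single_exponent[of i e c e' n] assms by (metis le_antisym)
qed

lemma demazure_exponents:
  assumes "\<And>e. e \<in> Poly_Mapping.keys f \<Longrightarrow> Poly_Mapping.keys e \<subseteq> {..<n} \<and> sq_norm n e \<le> M"
    and "Suc i < n" and "e' \<in> Poly_Mapping.keys (demazure i f)"
  shows "Poly_Mapping.keys e' \<subseteq> {..<n} \<and> sq_norm n e' \<le> M"
proof -
  have "(\<Sum>e\<in>Poly_Mapping.keys f. Poly_Mapping.lookup (demazure_single i e (Poly_Mapping.lookup f e)) e') \<noteq> 0"
    using assms(3) by (simp add: in_keys_iff demazure_eq_sum lookup_sum)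
  then obtain e where e: "e \<in> Poly_Mapping.keys f"
      "Poly_Mapping.lookup (demazure_single i e (Poly_Mapping.lookup f e)) e' \<noteq> 0"
    by (meson sum.neutral)
  obtain p q where "e' = set_pair i e p q" "sq_norm n e' \<le> sq_norm n e"
    using demazure_single_exponent[OF e(2) assms(2)] by metis
  then show ?thesis
    using assms(1)[OF e(1)] keys_set_pair_subset assms(2) order_trans by metis
qed

lemma lookup_demazure_top:
  assumes "\<And>e. e \<in> Poly_Mapping.keys f \<Longrightarrow> sq_norm n e \<le> sq_norm n e'" and "Suc i < n"
  shows "Poly_Mapping.lookup (demazure i f) e' = Poly_Mapping.lookup f (sort_pair i e')"
proof -
  have "Poly_Mapping.lookup (demazure i f) e' =
      (\<Sum>e\<in>Poly_Mapping.keys f. if e = sort_pair i e' then Poly_Mapping.lookup f e else 0)"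
    unfolding demazure_eq_sum lookup_sum
    by (intro sum.cong refl lookup_demazure_single_top[where n = n] assms)
  also have "\<dots> = Poly_Mapping.lookup f (sort_pair i e')"
    by (simp add: in_keys_iff)
  finally show ?thesis .
qed

section \<open>The tableau criterion\<close>

text \<open>For fixed \<open>k\<close>, the counts for all \<open>t\<close> determine the multiset
  of the first \<open>k\<close> entries; comparing them for all \<open>t\<close> compares the sorted
  prefixes entrywise.\<close>

definition prefix_count :: "nat \<Rightarrow> nat \<Rightarrow> composition \<Rightarrow> nat" where
  "prefix_count k t a = card {j. j < k \<and> t < Poly_Mapping.lookup a j}"

lemma prefix_count_Suc:
  "prefix_count (Suc k) t a = prefix_count k t a + (if t < Poly_Mapping.lookup a k then 1 else 0)"
proof (cases "t < Poly_Mapping.lookup a k")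
  case True
  then have "{j. j < Suc k \<and> t < Poly_Mapping.lookup a j} =
      insert k {j. j < k \<and> t < Poly_Mapping.lookup a j}"
    using less_Suc_eq by blast
  then show ?thesis using True by (simp add: prefix_count_def)
next
  case False
  then have "{j. j < Suc k \<and> t < Poly_Mapping.lookup a j} =
      {j. j < k \<and> t < Poly_Mapping.lookup a j}"
    using less_Suc_eq by blast
  then show ?thesis using False by (simp add: prefix_count_def)
qed

text \<open>Only the prefix ending between the two swapped positions sees a different set of
  entries.\<close>

lemma prefix_count_swap_entries:
  "prefix_count k t (swap_entries i a) =
     (if k = Suc i then prefix_count i t a + (if t < Poly_Mapping.lookup a (Suc i) then 1 else 0)
      else prefix_count k t a)"
proof -
  have le: "prefix_count k t (swap_entries i a) = prefix_count k t a" if "k \<le> i" for k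
    unfolding prefix_count_def using that
    by (intro arg_cong[where f = card]) auto
  have ge: "prefix_count (Suc (Suc i) + d) t (swap_entries i a) = prefix_count (Suc (Suc i) + d) t a" for d
    by (induction d) (simp_all add: prefix_count_Suc le)
  consider "k \<le> i" | "k = Suc i" | d where "k = Suc (Suc i) + d"
    using le_Suc_ex[of "Suc (Suc i)" k] by (metis le_antisym not_less_eq_eq)
  then show ?thesis
  proof cases
    case 3
    then show ?thesis using ge[of d] by simp
  qed (simp_all add: le prefix_count_Suc)
qed

text \<open>Lower in Bruhat order means closer to weakly decreasing, hence larger prefix counts:
  \<open>b\<close> is the lower element. The last conjunct makes the first \<open>n\<close> entries
  of \<open>b\<close> a rearrangement of those of \<open>a\<close>.\<close>

definition dominated :: "nat \<Rightarrow> composition \<Rightarrow> composition \<Rightarrow> bool" where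
  "dominated n b a \<longleftrightarrow>
     Poly_Mapping.keys b \<subseteq> {..<n} \<and> Poly_Mapping.keys a \<subseteq> {..<n} \<and> sq_norm n b = sq_norm n a \<and>
     (\<forall>k t. prefix_count k t a \<le> prefix_count k t b) \<and> (\<forall>t. prefix_count n t b = prefix_count n t a)"

text \<open>A decreasing \<open>a\<close> already maximises all prefix counts: a prefix either lies
  wholly above \<open>t\<close> or contains every entry above \<open>t\<close>. So the counts
  agree.\<close>

lemma dominated_antimono:
  assumes dom: "dominated n b a" and anti: "antimono (Poly_Mapping.lookup a)"
  shows "b = a"
proof -
  have eq: "prefix_count k t b = prefix_count k t a" if "k \<le> n" for k t
  proof -
    have "prefix_count k t b \<le> prefix_count k t a"
    proof (cases "\<forall>j<k. t < Poly_Mapping.lookup a j")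
      case True
      then have "{j. j < k \<and> t < Poly_Mapping.lookup a j} = {..<k}" by auto
      then have "prefix_count k t a = k" by (simp add: prefix_count_def)
      moreover have "prefix_count k t b \<le> card {..<k}"
        unfolding prefix_count_def by (intro card_mono) auto
      ultimately show ?thesis by simp
    next
      case False
      then obtain j where j: "j < k" "Poly_Mapping.lookup a j \<le> t" by (auto simp: not_less)
      have "l < k" if "t < Poly_Mapping.lookup a l" for l
        using anti j that by (metis antimonoD not_le order_trans less_imp_le)
      then have "{j. j < k \<and> t < Poly_Mapping.lookup a j} = {j. j < n \<and> t < Poly_Mapping.lookup a j}"
        using \<open>k \<le> n\<close> by (auto intro: less_le_trans)
      then have "prefix_count k t a = prefix_count n t a" by (simp add: prefix_count_def)
      also have "\<dots> = prefix_count n t b" using dom by (simp add: dominated_def)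
      finally show ?thesis
        using \<open>k \<le> n\<close> unfolding prefix_count_def by (auto intro!: card_mono)
    qed
    then show ?thesis using dom by (meson dominated_def le_antisym)
  qed
  show ?thesis
  proof (rule poly_mapping_eqI)
    fix k
    show "Poly_Mapping.lookup b k = Poly_Mapping.lookup a k"
    proof (cases "k < n")
      case True
      \<comment> \<open>Consecutive prefix counts differ by the indicator that entry
        \<open>k\<close> exceeds \<open>t\<close>; all thresholds together recover the
        entry.\<close>
      have "t < Poly_Mapping.lookup b k \<longleftrightarrow> t < Poly_Mapping.lookup a k" for t
        using eq[of "Suc k" t] eq[of k t] True by (auto simp: prefix_count_Suc split: if_splits)
      then show ?thesis by (metis less_irrefl linorder_neqE_nat)
    next
      case False
      then have "k \<notin> Poly_Mapping.keys a" "k \<notin> Poly_Mapping.keys b"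
        using dom by (auto simp: dominated_def)
      then show ?thesis by (simp add: in_keys_iff)
    qed
  qed
qed

text \<open>Only the prefix of length \<open>Suc i\<close> needs care. If entry \<open>i\<close> of
  \<open>b\<close> is at most \<open>t\<close> while entry \<open>Suc i\<close> of \<open>a\<close>
  exceeds it, neither of the two entries of \<open>b\<close> exceeds \<open>t\<close>, and the
  inequality for length \<open>Suc (Suc i)\<close> suffices.\<close>

lemma dominated_swap_right:
  assumes dom: "dominated n b a" and i: "Suc i < n"
    and a: "Poly_Mapping.lookup a i < Poly_Mapping.lookup a (Suc i)"
    and b: "Poly_Mapping.lookup b (Suc i) \<le> Poly_Mapping.lookup b i"
  shows "dominated n b (swap_entries i a)"
proof -
  have le: "prefix_count k t a \<le> prefix_count k t b" for k t
    using dom by (simp add: dominated_def)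
  have "prefix_count (Suc i) t (swap_entries i a) \<le> prefix_count (Suc i) t b" for t
    using le[of i t] le[of "Suc i" t] le[of "Suc (Suc i)" t] a b
    by (auto simp: prefix_count_swap_entries prefix_count_Suc split: if_splits)
  then have "prefix_count k t (swap_entries i a) \<le> prefix_count k t b" for k t
    using le[of k t] by (cases "k = Suc i") (auto simp: prefix_count_swap_entries)
  then show ?thesis
    using dom i
    by (simp add: dominated_def sq_norm_swap_entries keys_swap_entries_subset prefix_count_swap_entries)
qed

lemma dominated_swap_left:
  assumes dom: "dominated n b a" and i: "Suc i < n"
    and b: "Poly_Mapping.lookup b i < Poly_Mapping.lookup b (Suc i)"
  shows "dominated n (swap_entries i b) a"
proof -
  have le: "prefix_count k t a \<le> prefix_count k t b" for k t
    using dom by (simp add: dominated_def)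
  have "prefix_count k t b \<le> prefix_count k t (swap_entries i b)" for k t
    using b by (auto simp: prefix_count_swap_entries prefix_count_Suc)
  then have "prefix_count k t a \<le> prefix_count k t (swap_entries i b)" for k t
    using le order_trans by blast
  then show ?thesis
    using dom i
    by (simp add: dominated_def sq_norm_swap_entries keys_swap_entries_subset prefix_count_swap_entries)
qed

text \<open>This is the lifting property. An ascent of \<open>b\<close> at \<open>i\<close> is
  sorted first, which only raises prefix counts, and then the descent case applies.\<close>

lemma dominated_lift:
  assumes "dominated n b a" and "Suc i < n"
    and "Poly_Mapping.lookup a i < Poly_Mapping.lookup a (Suc i)"
  shows "dominated n (sort_pair i b) (swap_entries i a)"
proof (cases "Poly_Mapping.lookup b (Suc i) \<le> Poly_Mapping.lookup b i")
  case True
  then show ?thesis using dominated_swap_right[OF assms] by (simp add: sort_pair_def)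
next
  case False
  then show ?thesis
    using dominated_swap_right[OF dominated_swap_left[OF assms(1,2)] assms(2,3)]
    by (simp add: sort_pair_def)
qed

text \<open>Both claims go through one induction: reading a coefficient through
  \<open>demazure\<close> at \<open>b\<close> requires that no exponent of the previous polynomial
  has larger norm than \<open>b\<close>.\<close>

lemma key_poly_top:
  assumes "Poly_Mapping.keys a \<subseteq> {..<n}"
  shows "(\<forall>e\<in>Poly_Mapping.keys (key_poly a). Poly_Mapping.keys e \<subseteq> {..<n} \<and> sq_norm n e \<le> sq_norm n a) \<and>
         (\<forall>b. dominated n b a \<longrightarrow> Poly_Mapping.lookup (key_poly a) b = 1)"
  using assms
proof (induction a rule: key_poly.induct)
  case (1 a)
  show ?case
  proof (cases "antimono (Poly_Mapping.lookup a)")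
    case True
    then have "key_poly a = xmonom a" by (simp add: key_poly.simps)
    then show ?thesis
      using True 1(2) dominated_antimono by (auto simp: xmonom_def)
  next
    case False
    define i where "i = (SOME i. Poly_Mapping.lookup a i < Poly_Mapping.lookup a (Suc i))"
    have "\<exists>i. Poly_Mapping.lookup a i < Poly_Mapping.lookup a (Suc i)"
      using False unfolding antimono_iff_le_Suc by (auto simp: not_le)
    then have asc: "Poly_Mapping.lookup a i < Poly_Mapping.lookup a (Suc i)"
      unfolding i_def by (rule someI_ex)
    \<comment> \<open>The larger entry of an ascent is positive, so the swap stays within the first
      \<open>n\<close> positions.\<close>
    then have "Suc i \<in> Poly_Mapping.keys a" by (simp add: in_keys_iff)
    with 1(2) have i: "Suc i < n" by auto
    have kp: "key_poly a = demazure i (key_poly (swap_entries i a))"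
      using False by (subst key_poly.simps) (simp add: i_def Let_def)
    note IH = 1(1)[OF False i_def keys_swap_entries_subset[OF 1(2) i]]
    have sq: "sq_norm n (swap_entries i a) = sq_norm n a" by (rule sq_norm_swap_entries[OF i])
    have "Poly_Mapping.lookup (key_poly a) b = 1" if "dominated n b a" for b
    proof -
      have "sq_norm n b = sq_norm n a" using that by (simp add: dominated_def)
      then have "Poly_Mapping.lookup (key_poly a) b =
          Poly_Mapping.lookup (key_poly (swap_entries i a)) (sort_pair i b)"
        unfolding kp using IH sq i by (intro lookup_demazure_top) auto
      also have "\<dots> = 1" using IH dominated_lift[OF that i asc] by blast
      finally show ?thesis .
    qed
    moreover have "Poly_Mapping.keys e \<subseteq> {..<n} \<and> sq_norm n e \<le> sq_norm n a"
      if "e \<in> Poly_Mapping.keys (key_poly a)" for e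
      using demazure_exponents[OF _ i that[unfolded kp]] IH sq by auto
    ultimately show ?thesis by blast
  qed
qed

section \<open>From Bruhat order to the tableau criterion\<close>

text \<open>Undoing an inversion cannot lengthen a permutation; inversions are injected into
  inversions. Below, the contrapositive shows that a Bruhat step exchanges a non-inverted
  pair.\<close>

lemma perm_length_transpose_le:
  assumes "i < j" "j < n" "u j < u i"
  shows "perm_length n (u \<circ> Transposition.transpose i j) \<le> perm_length n u"
proof -
  let ?t = "Transposition.transpose i j"
  \<comment> \<open>Pairs whose order the transposition keeps move with it, the others stay. As it
    is an involution, a moved pair never meets a fixed one.\<close>
  let ?f = "\<lambda>(a, b). if ?t a < ?t b then (?t a, ?t b) else (a, b)"
  have fin: "finite (inversions n u)"
    by (rule finite_subset[of _ "{..<n} \<times> {..<n}"]) (auto simp: inversions_def)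
  have inj: "inj_on ?f (inversions n (u \<circ> ?t))"
  proof (rule inj_onI)
    fix x y
    assume x: "x \<in> inversions n (u \<circ> ?t)" and y: "y \<in> inversions n (u \<circ> ?t)" and eq: "?f x = ?f y"
    obtain a b c d where xy: "x = (a, b)" "y = (c, d)" by fastforce
    have lt: "a < b" "c < d" using x y by (auto simp: xy inversions_def)
    have t: "?t (?t m) = m" for m by simp
    show "x = y"
    proof (cases "?t a < ?t b")
      case True
      then have fx: "?f x = (?t a, ?t b)" by (simp add: xy)
      show ?thesis
      proof (cases "?t c < ?t d")
        case True
        then have "?t a = ?t c" "?t b = ?t d" using eq fx by (simp_all add: xy)
        then show ?thesis using t xy by metis
      next
        case False
        then have "?t a = c" "?t b = d" using eq fx by (simp_all add: xy)
        then show ?thesis using t lt False by metis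
      qed
    next
      case False
      then have fx: "?f x = (a, b)" by (simp add: xy)
      show ?thesis
      proof (cases "?t c < ?t d")
        case True
        then have "?t c = a" "?t d = b" using eq fx by (simp_all add: xy)
        then show ?thesis using t lt False by metis
      next
        case False
        then show ?thesis using eq fx by (simp add: xy)
      qed
    qed
  qed
  have "?f ` inversions n (u \<circ> ?t) \<subseteq> inversions n u"
    using assms by (auto simp: inversions_def Transposition.transpose_def split: if_splits)
  then show ?thesis
    unfolding perm_length_def using card_inj_on_le[OF inj _ fin] by blast
qed

text \<open>A prefix count of the list permuted by \<open>u\<close>, indexed by source positions; a
  Bruhat step then just exchanges the targets of two sources.\<close>

definition perm_count :: "nat list \<Rightarrow> (nat \<Rightarrow> nat) \<Rightarrow> nat \<Rightarrow> nat \<Rightarrow> nat" where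
  "perm_count l u k t = card {m. m < length l \<and> u m < k \<and> t < l ! m}"

text \<open>The exchange moves the larger entry \<open>l ! i\<close> further back. Only
  \<open>j\<close> can newly be counted, and in that case \<open>i\<close> ceases to be.\<close>

lemma perm_count_transpose:
  assumes "i < j" "j < length l" "u i < u j" "l ! j \<le> l ! i"
  shows "perm_count l (u \<circ> Transposition.transpose i j) k t \<le> perm_count l u k t"
proof -
  let ?V = "{m. m < length l \<and> (u \<circ> Transposition.transpose i j) m < k \<and> t < l ! m}"
  let ?U = "{m. m < length l \<and> u m < k \<and> t < l ! m}"
  have fin: "finite ?U" by simp
  have "card ?V \<le> card ?U"
  proof (cases "?V \<subseteq> ?U")
    case True
    then show ?thesis by (rule card_mono[OF fin])
  next
    case False
    have "j \<in> ?V" "i \<notin> ?V" "i \<in> ?U"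
      using False assms by (auto simp: Transposition.transpose_def split: if_splits)
    moreover have "?V - {j} \<subseteq> ?U - {i}"
      using \<open>i \<notin> ?V\<close> by (auto simp: Transposition.transpose_def split: if_splits)
    then have "card (?V - {j}) \<le> card (?U - {i})" by (intro card_mono) auto
    moreover have "finite ?V" by simp
    ultimately show ?thesis
      using card.remove[of ?V j] card.remove[of ?U i] fin by linarith
  qed
  then show ?thesis by (simp add: perm_count_def)
qed

lemma perm_count_bruhat:
  assumes "(bruhat_step (length l))\<^sup>*\<^sup>* u v" "u permutes {..<length l}"
    and dec: "\<And>i j. i < j \<Longrightarrow> j < length l \<Longrightarrow> l ! j \<le> l ! i"
  shows "v permutes {..<length l} \<and> perm_count l v k t \<le> perm_count l u k t"
  using assms(1)
proof (induction rule: rtranclp_induct)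
  case base
  then show ?case using assms(2) by simp
next
  case (step v w)
  then obtain i j where ij: "i < j" "j < length l" "w = v \<circ> Transposition.transpose i j"
      "perm_length (length l) v < perm_length (length l) w"
    by (auto simp: bruhat_step_def)
  \<comment> \<open>The length went up, so the exchanged pair was not an inversion; injectivity of
    \<open>v\<close> then gives strict order.\<close>
  have "\<not> v j < v i" using perm_length_transpose_le[OF ij(1,2), of v] ij(3,4) by auto
  moreover have "v i \<noteq> v j"
    using step.IH ij(1) permutes_inj by (metis inj_eq less_irrefl)
  ultimately have "v i < v j" by simp
  then have "perm_count l w k t \<le> perm_count l v k t"
    unfolding ij(3) by (intro perm_count_transpose ij dec)
  moreover have "w permutes {..<length l}"
    unfolding ij(3) using step.IH ij(1,2) by (intro permutes_compose permutes_swap_id) auto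
  ultimately show ?case using step.IH by linarith
qed

text \<open>A minimum over naturals is attained once some permutation qualifies.
  \<open>permute_list p\<close> takes entry \<open>i\<close> from position \<open>p i\<close>,
  whereas \<open>sends\<close> puts entry \<open>i\<close> at \<open>w i\<close>, so the witness is
  \<open>inv p\<close>.\<close>

lemma sends_min_perm: "sends (min_perm g) (dec_rearr g) g"
proof -
  have "mset g = mset (dec_rearr g)" by (simp add: dec_rearr_def)
  then obtain p where p: "p permutes {..<length (dec_rearr g)}" "permute_list p (dec_rearr g) = g"
    by (rule mset_eq_permutation)
  have len: "length (dec_rearr g) = length g" by (simp add: dec_rearr_def)
  have "g ! inv p i = dec_rearr g ! i" if "i < length g" for i
  proof -
    have "inv p i < length g"
      using permutes_in_image[OF permutes_inv[OF p(1)], of i] that len by simp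
    then have "permute_list p (dec_rearr g) ! inv p i = dec_rearr g ! p (inv p i)"
      using permute_list_nth[OF p(1)] len by simp
    then show ?thesis using p permutes_inverses(1)[OF p(1)] by simp
  qed
  then have "sends (inv p) (dec_rearr g) g"
    using permutes_inv[OF p(1)] len by (simp add: sends_def)
  then show ?thesis unfolding min_perm_def by (rule arg_min_natI[where P = "\<lambda>w. sends w (dec_rearr g) g"])
qed

lemma prefix_count_sends:
  assumes "sends u l g"
  shows "prefix_count k t (pad g) = perm_count l u k t"
proof -
  have u: "u permutes {..<length g}" and len: "length l = length g"
    and gu: "\<And>i. i < length g \<Longrightarrow> g ! u i = l ! i"
    using assms by (auto simp: sends_def)
  have "{j. j < k \<and> t < nth_default 0 g j} = u ` {m. m < length l \<and> u m < k \<and> t < l ! m}"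
    (is "?A = ?B")
  proof
    show "?A \<subseteq> ?B"
    proof
      fix j assume j: "j \<in> ?A"
      \<comment> \<open>Beyond the list the default entry is 0, which exceeds no threshold.\<close>
      then have "j < length g" by (auto simp: nth_default_def split: if_splits)
      then obtain m where "m < length g" "j = u m"
        using permutes_image[OF u] by (metis imageE lessThan_iff)
      then show "j \<in> ?B" using j gu len \<open>j < length g\<close> by (auto simp: nth_default_def)
    qed
    show "?B \<subseteq> ?A"
    proof
      fix j assume "j \<in> ?B"
      then obtain m where m: "m < length g" "j = u m" "u m < k" "t < l ! m"
        by (auto simp: len)
      then have "j < length g" using permutes_in_image[OF u, of m] by simp
      then show "j \<in> ?A" using m gu[OF m(1)] by (simp add: nth_default_nth)
    qed
  qed
  moreover have "inj_on u {m. m < length l \<and> u m < k \<and> t < l ! m}"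
    using permutes_inj_on[OF u] .
  ultimately show ?thesis
    by (simp add: prefix_count_def perm_count_def card_image)
qed

lemma sq_norm_pad: "sq_norm (length g) (pad g) = (\<Sum>x\<in>#mset g. x\<^sup>2)"
proof -
  have "sq_norm (length g) (pad g) = (\<Sum>j<length g. (g ! j)\<^sup>2)"
    unfolding sq_norm_def by (rule sum.cong) (auto simp: nth_default_def)
  also have "\<dots> = sum_list (map (\<lambda>x. x\<^sup>2) g)"
    by (simp add: sum_list_sum_nth atLeast0LessThan)
  finally show ?thesis by (simp flip: sum_mset_sum_list)
qed

lemma keys_pad: "Poly_Mapping.keys (pad g) \<subseteq> {..<length g}"
  by (auto simp: in_keys_iff nth_default_def simp del: keys_nth split: if_splits)

text \<open>Both compositions are permutations of one decreasing list \<open>l\<close>, so their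
  prefix counts become \<open>perm_count l\<close> at two Bruhat-comparable permutations.\<close>

lemma comp_le_dominated:
  assumes "b \<preceq> a" "length a = n" "length b = n"
  shows "dominated n (pad b) (pad a)"
proof -
  define l where "l = dec_rearr a"
  have lb: "dec_rearr b = l" and br: "bruhat_le n (min_perm b) (min_perm a)"
    using assms by (auto simp: comp_le_def l_def)
  have len: "length l = n" using assms by (simp add: l_def dec_rearr_def)
  have sa: "sends (min_perm a) l a" and sb: "sends (min_perm b) l b"
    using sends_min_perm[of a] sends_min_perm[of b] lb by (auto simp: l_def)
  have dec: "l ! j \<le> l ! i" if "i < j" "j < length l" for i j
    using that unfolding l_def dec_rearr_def
    by (simp add: rev_nth sorted_nth_mono)
  have le: "prefix_count k t (pad a) \<le> prefix_count k t (pad b)" for k t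
    unfolding prefix_count_sends[OF sa] prefix_count_sends[OF sb]
    using perm_count_bruhat[of l "min_perm b" "min_perm a" k t] br dec
    by (auto simp: bruhat_le_def len)
  \<comment> \<open>In the full prefix every source index qualifies, so the count depends on
    \<open>l\<close> alone.\<close>
  have full: "perm_count l u n t = card {m. m < length l \<and> t < l ! m}" if "sends u l g" for u t g
  proof -
    have "u m < n" if "m < length l" for m
      using \<open>sends u l g\<close> that len permutes_in_image[of u "{..<n}" m] by (simp add: sends_def)
    then show ?thesis unfolding perm_count_def by (intro arg_cong[where f = card]) auto
  qed
  have "mset b = mset a"
    using lb by (metis l_def dec_rearr_def mset_rev mset_sort)
  then have "sq_norm n (pad b) = sq_norm n (pad a)"
    using sq_norm_pad assms by metis
  then show ?thesis
    using le full[OF sa] full[OF sb] keys_pad[of a, unfolded assms(2)] keys_pad[of b, unfolded assms(3)]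
    by (simp add: dominated_def prefix_count_sends[OF sa] prefix_count_sends[OF sb] del: keys_nth)
qed

section \<open>Strict convexity of the norm\<close>

lemma lookup_scaleR: "Poly_Mapping.lookup (c *\<^sub>R v) j = c * Poly_Mapping.lookup v j"
  for v :: "nat \<Rightarrow>\<^sub>0 real"
proof -
  have "finite {i. c * Poly_Mapping.lookup v i \<noteq> 0}"
    by (rule finite_subset[OF _ finite_keys[of v]]) (auto simp: in_keys_iff)
  then show ?thesis by (simp add: scaleR_poly_mapping_def)
qed

definition real_sq_norm :: "nat \<Rightarrow> (nat \<Rightarrow>\<^sub>0 real) \<Rightarrow> real" where
  "real_sq_norm n v = (\<Sum>j<n. (Poly_Mapping.lookup v j)\<^sup>2)"

lemma real_sq_norm_nonneg: "0 \<le> real_sq_norm n v"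
  by (simp add: real_sq_norm_def sum_nonneg)

text \<open>The identity holds coordinatewise. Its last term is the exact convexity defect:
  nonnegativity gives convex balls, positivity gives strictness.\<close>

lemma real_sq_norm_convex_comb:
  "real_sq_norm n ((1 - u) *\<^sub>R x + u *\<^sub>R y) =
     (1 - u) * real_sq_norm n x + u * real_sq_norm n y - u * (1 - u) * real_sq_norm n (x - y)"
  unfolding real_sq_norm_def sum_distrib_left sum.distrib[symmetric] sum_subtractf[symmetric]
  by (rule sum.cong)
     (simp_all add: lookup_add lookup_minus lookup_scaleR power2_eq_square algebra_simps)

lemma convex_euclid_ball: "convex {v \<in> euclid n. real_sq_norm n v \<le> M}"
  unfolding convex_alt
proof safe
  fix x y :: "nat \<Rightarrow>\<^sub>0 real" and u :: real
  assume x: "x \<in> euclid n" "real_sq_norm n x \<le> M" and y: "y \<in> euclid n" "real_sq_norm n y \<le> M"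
    and u: "0 \<le> u" "u \<le> 1"
  show "(1 - u) *\<^sub>R x + u *\<^sub>R y \<in> euclid n"
    using x(1) y(1) unfolding euclid_def
    by (simp add: lookup_add lookup_scaleR in_keys_iff subset_iff)
       (metis add.right_neutral mult_zero_right)
  have "u * (1 - u) * real_sq_norm n (x - y) \<ge> 0"
    using u by (simp add: real_sq_norm_nonneg)
  moreover have "(1 - u) * real_sq_norm n x + u * real_sq_norm n y \<le> M"
    using convex_bound_le[OF x(2) y(2), of "1 - u" u] u by simp
  ultimately show "real_sq_norm n ((1 - u) *\<^sub>R x + u *\<^sub>R y) \<le> M"
    by (simp add: real_sq_norm_convex_comb)
qed

text \<open>Only coordinates below \<open>n\<close> are summed; membership in
  \<open>euclid n\<close> ensures that a difference shows up there.\<close>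

lemma real_sq_norm_pos:
  assumes "x \<in> euclid n" "y \<in> euclid n" "x \<noteq> y"
  shows "0 < real_sq_norm n (x - y)"
proof -
  obtain j where j: "Poly_Mapping.lookup x j \<noteq> Poly_Mapping.lookup y j"
    using assms(3) by (metis poly_mapping_eqI)
  then have "Poly_Mapping.lookup x j \<noteq> 0 \<or> Poly_Mapping.lookup y j \<noteq> 0" by auto
  then have "j < n" using assms(1,2) by (auto simp: euclid_def in_keys_iff subset_iff)
  then show ?thesis
    unfolding real_sq_norm_def using j by (intro sum_pos2[of _ j]) (auto simp: lookup_minus)
qed

lemma extreme_point_of_max_norm:
  assumes "x \<in> S" "S \<subseteq> euclid n" and max: "\<And>y. y \<in> S \<Longrightarrow> real_sq_norm n y \<le> real_sq_norm n x"
  shows "x extreme_point_of S"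
  unfolding extreme_point_of_def
proof (intro conjI ballI notI)
  fix a b assume a: "a \<in> S" and b: "b \<in> S" and "x \<in> open_segment a b"
  then obtain u where ab: "a \<noteq> b" and u: "0 < u" "u < 1" and x: "x = (1 - u) *\<^sub>R a + u *\<^sub>R b"
    by (auto simp: in_segment)
  have "0 < u * (1 - u) * real_sq_norm n (a - b)"
    using u real_sq_norm_pos[of a n b] ab a b assms(2) by (auto intro!: mult_pos_pos)
  moreover have "(1 - u) * real_sq_norm n a + u * real_sq_norm n b \<le> real_sq_norm n x"
    using convex_bound_le[OF max[OF a] max[OF b], of "1 - u" u] u by simp
  ultimately show False
    using real_sq_norm_convex_comb[of n u a b] x by simp
qed (rule assms(1))

lemma lookup_real_vec: "Poly_Mapping.lookup (real_vec e) j = real (Poly_Mapping.lookup e j)"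
  by (simp add: real_vec_def Poly_Mapping.map.rep_eq when_def)

lemma real_sq_norm_real_vec: "real_sq_norm n (real_vec e) = real (sq_norm n e)"
  by (simp add: real_sq_norm_def sq_norm_def lookup_real_vec)

lemma real_vec_in_euclid: "real_vec e \<in> euclid n \<longleftrightarrow> Poly_Mapping.keys e \<subseteq> {..<n}"
  by (auto simp: euclid_def in_keys_iff lookup_real_vec subset_iff)

theorem theorem3p12:
  fixes n :: nat and \<alpha> \<beta> :: "nat list"
  assumes "length \<alpha> = n" and "length \<beta> = n"
    and "\<beta> \<preceq> \<alpha>"
  shows "Newton (key_poly (pad \<alpha>)) \<subseteq> euclid n \<and>
         real_vec (pad \<beta>) extreme_point_of Newton (key_poly (pad \<alpha>))"
proof -
  let ?K = "key_poly (pad \<alpha>)"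
  have dom: "dominated n (pad \<beta>) (pad \<alpha>)"
    using assms by (intro comp_le_dominated)
  then have keys: "Poly_Mapping.keys (pad \<alpha>) \<subseteq> {..<n}"
    and sq: "sq_norm n (pad \<beta>) = sq_norm n (pad \<alpha>)"
    by (auto simp: dominated_def)
  note top = key_poly_top[OF keys]
  \<comment> \<open>Since \<alpha> and \<beta> have equal norm, the bound on the exponents places
    them in the ball with \<beta> on its boundary; this ball is convex and so contains the
    hull.\<close>
  have "real_vec ` Poly_Mapping.keys ?K \<subseteq>
      {v \<in> euclid n. real_sq_norm n v \<le> real_sq_norm n (real_vec (pad \<beta>))}"
    using top by (auto simp: real_vec_in_euclid real_sq_norm_real_vec sq)
  then have sub: "Newton ?K \<subseteq> {v \<in> euclid n. real_sq_norm n v \<le> real_sq_norm n (real_vec (pad \<beta>))}"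
    unfolding Newton_def by (rule hull_minimal) (rule convex_euclid_ball)
  have "pad \<beta> \<in> Poly_Mapping.keys ?K" using top dom by (simp add: in_keys_iff)
  then have "real_vec (pad \<beta>) \<in> Newton ?K" by (simp add: Newton_def hull_inc)
  then show ?thesis
    using sub by (auto intro!: extreme_point_of_max_norm)
qed

end
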